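(* Let $1\le k\le n-1$. For every $\varepsilon\in E$, let $y\in W^J$ be the unique element with $y(\mathbf 1)=\varepsilon$. Then $\varphi(C'^J_y)=Q_\varepsilon$. In other words, the polynomials $Q_\varepsilon$, $\varepsilon\in E$, form the image under $\varphi$ of the parabolic Kazhdan–Lusztig basis of $M'$.
   Context: Let $\mathcal H$ be the Hecke algebra of $S_n$ over $\mathbb Q(v)$, generated by $T_1,\dots,T_{n-1}$ with braid relations and $(T_i-v)(T_i+v^{-1})=0$; bar involution: ring involution with $\overline v=v^{-1}$, $\overline{T_w}=T_{w^{-1}}^{-1}$. Let $E$ be the set of sequences of $n$ signs $\pm$ with exactly $k$ pluses, with $S_n$ permuting positions; $\mathbf 1=(+^k,-^{n-k})$. Let $M'=\bigoplus_{\varepsilon\in E}\mathbb Q(v)\varepsilon$ with $\mathcal H$-action: $T_i\varepsilon=s_i\varepsilon$ if $(\varepsilon_i,\varepsilon_{i+1})=(+,-)$; $T_i\varepsilon=v\varepsilon$ if $(\varepsilon_i,\varepsilon_{i+1})\in\{(+,+),(-,-)\}$; $T_i\varepsilon=s_i\varepsilon+(v-v^{-1})\varepsilon$ if $(\varepsilon_i,\varepsilon_{i+1})=(-,+)$ (this is the module induced from the one-dimensional representation $T_j\mapsto v$, $j\neq k$, of the parabolic subalgebra). $M'$ carries the bar involution $\overline{h\mathbf 1}=\overline h\,\mathbf 1$. $W^J$ is the set of minimal length representatives of $S_n/(S_k\times S_{n-k})$, and $y\mapsto y(\mathbf 1)$ is a bijection $W^J\to E$. The parabolic Kazhdan–Lusztig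 element $C'^J_y\in M'$ ($y\in W^J$) is the unique element with $\overline{C'^J_y}=C'^J_y$ and $C'^J_y-y(\mathbf 1)\in\sum_\varepsilon v\mathbb Z[v]\varepsilon$. For $\varepsilon\in E$ let $N(\varepsilon)=\#\{(i,j):i<j,\ \varepsilon_i=-,\ \varepsilon_j=+\}$ (this equals $|\lambda|$ when $\varepsilon=w_\lambda(\mathbf 1)$). Let $\mathcal P(k,n)$ be the $\mathbb Q(v)$-span of the square-free monomials of degree $n-k$ in $x_1,\dots,x_n$, and let $\varphi:M'\to\mathcal P(k,n)$ be the $\mathbb Q(v)$-linear isomorphism $\varphi(\varepsilon)=v^{-N(\varepsilon)}\prod_{i:\varepsilon_i=-}x_i$. For $\varepsilon\in E$ define $Q_\varepsilon$ as follows: pair minuses with pluses as opening and closing parentheses are matched (a minus is an opening parenthesis, a plus a closing one; each plus is matched with the nearest preceding unmatched minus, if any). Replace each pair consisting of a minus at position $i$ and a plus at position $j$ by the factor $x_i-v^{j+1-i}x_j$, each unpaired minus at position $i$ by the factor $x_i$ (unpaired pluses contribute nothing), and let $Q_\varepsilon$ be $v^{-N(\varepsilon)}$ times the product of all these factors. *)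

theory Defs
  imports "HOL-Computational_Algebra.Polynomial" "HOL-Computational_Algebra.Fraction_Field"
          "HOL-Library.Poly_Mapping"
begin

type_synonym qv = "int poly fract"

definition vv :: qv where "vv = Fract [:0, 1:] 1"

definition ev_inv :: "int poly \<Rightarrow> qv" where
  "ev_inv p = poly (map_poly (\<lambda>a. Fract [:a:] 1) p) (inverse vv)"

definition bar_qv :: "qv \<Rightarrow> qv" where
  "bar_qv f = (THE g. \<exists>p q. q \<noteq> 0 \<and> f = Fract p q \<and> g = ev_inv p / ev_inv q)"

text \<open>A sign sequence is a list of booleans; True = plus, False = minus.
  Positions are 0-based (position i here is position i+1 in the paper).\<close>

definition Eset :: "nat \<Rightarrow> nat \<Rightarrow> bool list set" where
  "Eset n k = {e. length e = n \<and> length (filter id e) = k}"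

definition one_seq :: "nat \<Rightarrow> nat \<Rightarrow> bool list" where
  "one_seq n k = replicate k True @ replicate (n - k) False"

type_synonym mod_elt = "bool list \<Rightarrow> qv"

definition Mspace :: "nat \<Rightarrow> nat \<Rightarrow> mod_elt set" where
  "Mspace n k = {m. \<forall>e. e \<notin> Eset n k \<longrightarrow> m e = 0}"

definition bvec :: "bool list \<Rightarrow> mod_elt" where
  "bvec e = (\<lambda>d. if d = e then 1 else 0)"

definition smul :: "qv \<Rightarrow> mod_elt \<Rightarrow> mod_elt" where
  "smul c m = (\<lambda>d. c * m d)"

definition swp :: "nat \<Rightarrow> bool list \<Rightarrow> bool list" where
  "swp i e = e[i := e ! (i+1), i+1 := e ! i]"

definition T_basis :: "nat \<Rightarrow> bool list \<Rightarrow> mod_elt" where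
  "T_basis i e =
     (if e ! i \<and> \<not> e ! (i+1) then bvec (swp i e)
      else if e ! i = e ! (i+1) then smul vv (bvec e)
      else (\<lambda>d. bvec (swp i e) d + (vv - inverse vv) * bvec e d))"

definition T_act :: "nat \<Rightarrow> nat \<Rightarrow> nat \<Rightarrow> mod_elt \<Rightarrow> mod_elt" where
  "T_act n k i m = (\<lambda>d. \<Sum>e\<in>Eset n k. m e * T_basis i e d)"

text \<open>T_i^{-1} = T_i - (v - v^{-1}), by the quadratic relation.\<close>
definition Tinv_act :: "nat \<Rightarrow> nat \<Rightarrow> nat \<Rightarrow> mod_elt \<Rightarrow> mod_elt" where
  "Tinv_act n k i m = (\<lambda>d. T_act n k i m d - (vv - inverse vv) * m d)"

text \<open>Bar involution on M': additive, bar-semilinear, fixes 1, and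
  bar(T_i m) = T_i^{-1} bar(m) (equivalently bar(h 1) = bar(h) 1, since
  bar(T_i) = T_i^{-1} and H is generated by the T_i over Q(v)).\<close>
definition is_bar_M :: "nat \<Rightarrow> nat \<Rightarrow> (mod_elt \<Rightarrow> mod_elt) \<Rightarrow> bool" where
  "is_bar_M n k \<beta> \<longleftrightarrow>
     (\<forall>m\<in>Mspace n k. \<beta> m \<in> Mspace n k) \<and>
     (\<forall>m1\<in>Mspace n k. \<forall>m2\<in>Mspace n k. \<beta> (\<lambda>d. m1 d + m2 d) = (\<lambda>d. \<beta> m1 d + \<beta> m2 d)) \<and>
     (\<forall>c. \<forall>m\<in>Mspace n k. \<beta> (smul c m) = smul (bar_qv c) (\<beta> m)) \<and>
     \<beta> (bvec (one_seq n k)) = bvec (one_seq n k) \<and>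
     (\<forall>i. i + 1 < n \<longrightarrow> (\<forall>m\<in>Mspace n k. \<beta> (T_act n k i m) = Tinv_act n k i (\<beta> m)))"

definition bar_M :: "nat \<Rightarrow> nat \<Rightarrow> mod_elt \<Rightarrow> mod_elt" where
  "bar_M n k = (SOME \<beta>. is_bar_M n k \<beta>)"

definition in_vZv :: "qv \<Rightarrow> bool" where
  "in_vZv c \<longleftrightarrow> (\<exists>p :: int poly. coeff p 0 = 0 \<and> c = Fract p 1)"

text \<open>Parabolic KL element C'^J_y, indexed by e = y(1).\<close>
definition KL_elt :: "nat \<Rightarrow> nat \<Rightarrow> bool list \<Rightarrow> mod_elt" where
  "KL_elt n k e = (THE C. C \<in> Mspace n k \<and> bar_M n k C = C \<and>
                        (\<forall>d\<in>Eset n k. in_vZv (C d - bvec e d)))"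

type_synonym mpoly = "(nat \<Rightarrow>\<^sub>0 nat) \<Rightarrow>\<^sub>0 qv"

definition Xv :: "nat \<Rightarrow> mpoly" where
  "Xv i = Poly_Mapping.single (Poly_Mapping.single i 1) 1"

definition Cst :: "qv \<Rightarrow> mpoly" where
  "Cst c = Poly_Mapping.single 0 c"

definition Ninv :: "bool list \<Rightarrow> nat" where
  "Ninv e = card {(i, j). i < j \<and> j < length e \<and> \<not> e ! i \<and> e ! j}"

definition minus_monomial :: "bool list \<Rightarrow> mpoly" where
  "minus_monomial e = (\<Prod>i\<in>{i. i < length e \<and> \<not> e ! i}. Xv i)"

definition phi :: "nat \<Rightarrow> nat \<Rightarrow> mod_elt \<Rightarrow> mpoly" where
  "phi n k m = (\<Sum>e\<in>Eset n k. Cst (m e * inverse vv ^ Ninv e) * minus_monomial e)"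

text \<open>Parenthesis matching: minus = opening, plus = closing. Argument p is the
  current position, st the stack of unmatched minus positions. Returns the list
  of matched pairs (i, j) (minus at i, plus at j) and the unmatched minuses.\<close>
fun match_aux :: "bool list \<Rightarrow> nat \<Rightarrow> nat list \<Rightarrow> (nat \<times> nat) list \<times> nat list" where
  "match_aux [] p st = ([], st)"
| "match_aux (False # xs) p st = match_aux xs (Suc p) (p # st)"
| "match_aux (True # xs) p [] = match_aux xs (Suc p) []"
| "match_aux (True # xs) p (i # st) =
     (let r = match_aux xs (Suc p) st in ((i, p) # fst r, snd r))"

definition Qpoly :: "bool list \<Rightarrow> mpoly" where
  "Qpoly e = (let r = match_aux e 0 [] in
     Cst (inverse vv ^ Ninv e) *
     (\<Prod>(i, j)\<leftarrow>fst r. Xv i - Cst (vv ^ (j + 1 - i)) * Xv j) *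
     (\<Prod>i\<leftarrow>snd r. Xv i))"

end

(*
  Let b_e be the sum over all sets S of arcs of e of (-v)^|S| times the sequence obtained from e by
  exchanging the two signs of each arc in S. If e arises from e0 by inserting an adjacent pair
  minus-plus, then b_e arises from b_(e0) by inserting the cup (-+) - v(+-) at the same place. Now
  T_i - v is a cap at i, i+1 followed by that cup, and by induction on the length (sliding the cap past
  a cup, straightening a zigzag or closing a loop) it sends b_e to 0, b_(e') or -(v + 1/v) b_e.
  Hence the semilinear map fixing all b_e satisfies the axioms of the bar involution; as the b_e are
  unitriangular with off-diagonal entries in v Z[v], they are the parabolic Kazhdan-Lusztig elements.
  Finally N(e) plus the sum of the positions of the minuses is constant, so with y_i = v^i x_i both
  phi(b_e) and Q_e become the same constant times the product of the y_i - v y_j over the arcs and the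
  y_i over the unpaired minuses.
*)
theory Submission
  imports Defs
begin

section \<open>The bar involution of the scalars\<close>

definition emb :: "int poly \<Rightarrow> qv" where "emb p = Fract p 1"

lemma emb_simps [simp]:
  "emb 0 = 0" "emb 1 = 1" "emb (p + q) = emb p + emb q" "emb (p * q) = emb p * emb q"
  "emb (- p) = - emb p" "emb p = emb q \<longleftrightarrow> p = q"
  by (simp_all add: emb_def Zero_fract_def One_fract_def eq_fract)

lemma emb_eq_0_iff [simp]: "emb p = 0 \<longleftrightarrow> p = 0"
  using emb_simps(1,6) by metis

lemma emb_power [simp]: "emb (p ^ m) = emb p ^ m"
  by (induction m) auto

lemma emb_sum [simp]: "emb (sum f A) = (\<Sum>x\<in>A. emb (f x))"
  by (induction A rule: infinite_finite_induct) auto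

lemma vv_emb: "vv = emb [:0, 1:]"
  by (simp add: vv_def emb_def)

lemma vv_nonzero [simp]: "vv \<noteq> 0"
  by (simp add: vv_emb)

lemma ev_inv_0 [simp]: "ev_inv 0 = 0"
  by (simp add: ev_inv_def)

lemma ev_inv_pCons: "ev_inv (pCons a p) = emb [:a:] + inverse vv * ev_inv p"
  by (simp add: ev_inv_def map_poly_pCons flip: emb_def)

lemma ev_inv_1 [simp]: "ev_inv 1 = 1"
  using ev_inv_pCons[of 1 0] by (simp flip: one_pCons)

lemma emb_const_add: "emb [:a + b:] = emb [:a:] + emb [:b:]"
  by (simp flip: emb_simps(3))

lemma ev_inv_add [simp]: "ev_inv (p + q) = ev_inv p + ev_inv q"
  by (induction p q rule: poly_induct2) (simp_all add: ev_inv_pCons emb_const_add algebra_simps)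

lemma ev_inv_smult: "ev_inv (smult a p) = emb [:a:] * ev_inv p"
  by (induction p) (simp_all add: ev_inv_pCons algebra_simps flip: emb_simps(4))

lemma ev_inv_mult [simp]: "ev_inv (p * q) = ev_inv p * ev_inv q"
  by (induction p) (simp_all add: ev_inv_pCons ev_inv_smult algebra_simps)

lemma ev_inv_sum_coeff: "ev_inv p = (\<Sum>i\<le>degree p. emb [:coeff p i:] * inverse vv ^ i)"
proof -
  have "ev_inv p = poly (map_poly (\<lambda>a. emb [:a:]) p) (inverse vv)"
    by (simp add: ev_inv_def emb_def)
  also have "\<dots> = (\<Sum>i\<le>degree (map_poly (\<lambda>a. emb [:a:]) p).
      coeff (map_poly (\<lambda>a. emb [:a:]) p) i * inverse vv ^ i)"
    by (simp add: poly_altdef)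
  also have "degree (map_poly (\<lambda>a. emb [:a:]) p) = degree p"
    by (rule degree_map_poly) simp
  finally show ?thesis by (simp add: coeff_map_poly)
qed

lemma emb_sum_coeff: "emb p = (\<Sum>i\<le>degree p. emb [:coeff p i:] * vv ^ i)"
proof -
  have "p = (\<Sum>i\<le>degree p. [:coeff p i:] * [:0, 1:] ^ i)"
    by (subst poly_as_sum_of_monoms[of p, symmetric]) (simp add: monom_altdef)
  then have "emb p = emb (\<Sum>i\<le>degree p. [:coeff p i:] * [:0, 1:] ^ i)"
    by (rule arg_cong)
  then show ?thesis by (simp add: vv_emb del: mult_pCons_left)
qed

text \<open>Multiplying p(1/v) by the top power of v clears denominators and reverses the
  coefficients. It makes \<open>ev_inv p\<close> nonzero for nonzero \<open>p\<close>, so that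
  \<open>ev_inv\<close> may be applied to denominators.\<close>

lemma ev_inv_reflect: "vv ^ degree p * ev_inv p = emb (reflect_poly p)"
proof -
  define n where "n = degree p"
  have "emb (reflect_poly p) = (\<Sum>i\<le>n. emb [:coeff (reflect_poly p) i:] * vv ^ i)"
  proof -
    have "degree (reflect_poly p) \<le> n"
      by (simp add: n_def degree_reflect_poly_le)
    then have "(\<Sum>i\<le>n. emb [:coeff (reflect_poly p) i:] * vv ^ i) =
        (\<Sum>i\<le>degree (reflect_poly p). emb [:coeff (reflect_poly p) i:] * vv ^ i)"
      by (intro sum.mono_neutral_right ballI) (simp_all add: coeff_eq_0)
    then show ?thesis by (simp only: emb_sum_coeff[of "reflect_poly p"])
  qed
  also have "\<dots> = (\<Sum>i\<le>n. emb [:coeff p (n - i):] * vv ^ i)"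
    by (intro sum.cong) (auto simp: coeff_reflect_poly n_def)
  also have "\<dots> = (\<Sum>i\<le>n. emb [:coeff p i:] * vv ^ (n - i))"
    by (subst sum.atLeastAtMost_rev[of _ 0 n, simplified atLeast0AtMost]) simp
  also have "\<dots> = (\<Sum>i\<le>n. vv ^ n * (emb [:coeff p i:] * inverse vv ^ i))"
    by (intro sum.cong refl) (simp add: power_diff field_simps power_inverse)
  also have "\<dots> = vv ^ n * ev_inv p"
    by (simp add: ev_inv_sum_coeff sum_distrib_left n_def)
  finally show ?thesis by (simp add: n_def)
qed

lemma ev_inv_eq_0_iff [simp]: "ev_inv p = 0 \<longleftrightarrow> p = 0"
proof
  assume "ev_inv p = 0"
  then have "emb (reflect_poly p) = 0" by (simp flip: ev_inv_reflect)
  then show "p = 0" by simp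
qed simp

text \<open>Cross-multiplied equality of two representations survives the ring homomorphism
  \<open>ev_inv\<close>, so the description in \<open>bar_qv\<close> is unambiguous.\<close>

lemma bar_qv_Fract:
  assumes "q \<noteq> 0"
  shows "bar_qv (Fract p q) = ev_inv p / ev_inv q"
  unfolding bar_qv_def
proof (rule the_equality)
  show "\<exists>p' q'. q' \<noteq> 0 \<and> Fract p q = Fract p' q' \<and> ev_inv p / ev_inv q = ev_inv p' / ev_inv q'"
    using assms by blast
next
  fix g assume "\<exists>p' q'. q' \<noteq> 0 \<and> Fract p q = Fract p' q' \<and> g = ev_inv p' / ev_inv q'"
  then obtain p' q' where *: "q' \<noteq> 0" "Fract p q = Fract p' q'" "g = ev_inv p' / ev_inv q'"
    by blast
  then have "p * q' = p' * q" using assms by (simp add: eq_fract)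
  then have "ev_inv p * ev_inv q' = ev_inv p' * ev_inv q" by (metis ev_inv_mult)
  then show "g = ev_inv p / ev_inv q"
    unfolding *(3) using *(1) assms by (subst frac_eq_eq) simp_all
qed

lemma bar_qv_emb: "bar_qv (emb p) = ev_inv p"
  by (simp add: emb_def bar_qv_Fract)

lemma bar_qv_add [simp]: "bar_qv (x + y) = bar_qv x + bar_qv y"
  by (cases x; cases y) (simp add: bar_qv_Fract add_frac_eq)

lemma bar_qv_mult [simp]: "bar_qv (x * y) = bar_qv x * bar_qv y"
  by (cases x; cases y) (simp add: bar_qv_Fract)

lemma bar_qv_0 [simp]: "bar_qv 0 = 0" and bar_qv_1 [simp]: "bar_qv 1 = 1"
  using bar_qv_emb[of 0] bar_qv_emb[of 1] by simp_all

lemma bar_qv_minus [simp]: "bar_qv (- x) = - bar_qv x"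
  using bar_qv_add[of x "- x"] by (simp add: eq_neg_iff_add_eq_0 add.commute del: bar_qv_add)

lemma bar_qv_diff [simp]: "bar_qv (x - y) = bar_qv x - bar_qv y"
  using bar_qv_add[of x "- y"] by simp

lemma bar_qv_sum [simp]: "bar_qv (sum f A) = (\<Sum>x\<in>A. bar_qv (f x))"
  by (induction A rule: infinite_finite_induct) auto

lemma bar_qv_vv [simp]: "bar_qv vv = inverse vv"
proof -
  have "ev_inv (pCons 0 1) = inverse vv"
    using ev_inv_pCons[of 0 1] by simp
  then show ?thesis
    by (simp only: vv_emb bar_qv_emb one_pCons)
qed

lemma bar_qv_inverse_vv [simp]: "bar_qv (inverse vv) = vv"
  using bar_qv_mult[of vv "inverse vv"] by (simp add: field_simps del: bar_qv_mult)

text \<open>If p(1/v) = p(v), then v^(deg p) p is the reversal of p, so 2 deg p \<le> deg p. Hence p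
  is constant, with constant term 0. This gives the uniqueness of the Kazhdan-Lusztig
  elements.\<close>

lemma in_vZv_bar_fixed:
  assumes "in_vZv c" "bar_qv c = c"
  shows "c = 0"
proof -
  obtain p where p: "coeff p 0 = 0" "c = emb p"
    using assms(1) by (auto simp: in_vZv_def emb_def)
  have "emb (monom 1 (degree p) * p) = vv ^ degree p * ev_inv p"
    using assms(2) p by (simp add: monom_altdef vv_emb bar_qv_emb)
  then have eq: "monom 1 (degree p) * p = reflect_poly p"
    by (simp add: ev_inv_reflect del: emb_simps(4))
  have "p = 0"
  proof (rule ccontr)
    assume "p \<noteq> 0"
    then have "degree (monom 1 (degree p) * p) = degree p + degree p"
      by (simp add: degree_mult_eq degree_monom_eq)
    then have "degree p = 0"
      using eq degree_reflect_poly_le[of p] by simp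
    then show False using p \<open>p \<noteq> 0\<close> by (metis leading_coeff_0_iff)
  qed
  then show ?thesis using p by simp
qed

lemma in_vZv_iff: "in_vZv c \<longleftrightarrow> (\<exists>p. coeff p 0 = 0 \<and> c = emb p)"
  by (simp add: in_vZv_def emb_def)

lemma in_vZv_0 [simp]: "in_vZv 0"
  unfolding in_vZv_iff by (rule exI[of _ 0]) simp

lemma in_vZv_vv [simp]: "in_vZv vv"
  unfolding in_vZv_iff vv_emb by (rule exI[of _ "[:0, 1:]"]) simp

lemma in_vZv_add: "in_vZv c \<Longrightarrow> in_vZv c' \<Longrightarrow> in_vZv (c + c')"
  unfolding in_vZv_iff by (metis coeff_add add_0 emb_simps(3))

lemma in_vZv_minus: "in_vZv c \<Longrightarrow> in_vZv (- c)"
  unfolding in_vZv_iff by (metis coeff_minus neg_equal_0_iff_equal emb_simps(5))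

lemma in_vZv_diff: "in_vZv c \<Longrightarrow> in_vZv c' \<Longrightarrow> in_vZv (c - c')"
  using in_vZv_add[of c "- c'"] in_vZv_minus by simp

lemma in_vZv_mult: "in_vZv c \<Longrightarrow> in_vZv c' \<Longrightarrow> in_vZv (c * c')"
  unfolding in_vZv_iff by (metis coeff_mult_0 mult_zero_left emb_simps(4))

section \<open>Arc coefficients\<close>

definition cup_coeff :: "bool \<Rightarrow> bool \<Rightarrow> qv" where
  "cup_coeff a b = (if a = b then 0 else if b then 1 else - vv)"

lemma cup_coeff_simps [simp]:
  "cup_coeff a a = 0" "cup_coeff False True = 1" "cup_coeff True False = - vv"
  by (simp_all add: cup_coeff_def)

text \<open>Both lists are read from left to right. The stack \<open>st\<close> holds the entries of
  \<open>d\<close> at the minuses of \<open>e\<close> still open, innermost first. A plus closes an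
  arc, whose two entries in \<open>d\<close> are weighted as in the cup (-+) - v(+-); unpaired signs
  must agree in \<open>d\<close> and \<open>e\<close>.\<close>

fun arc_coeff :: "bool list \<Rightarrow> bool list \<Rightarrow> bool list \<Rightarrow> qv" where
  "arc_coeff [] [] st = (if True \<in> set st then 0 else 1)"
| "arc_coeff [] (y # d) st = 0"
| "arc_coeff (x # e) [] st = 0"
| "arc_coeff (False # e) (y # d) st = arc_coeff e d (y # st)"
| "arc_coeff (True # e) (y # d) [] = (if y then arc_coeff e d [] else 0)"
| "arc_coeff (True # e) (y # d) (s # st) = cup_coeff s y * arc_coeff e d st"

text \<open>The element b_e, to be identified with the parabolic Kazhdan-Lusztig element.\<close>

definition kl :: "bool list \<Rightarrow> mod_elt" where
  "kl e = (\<lambda>d. arc_coeff e d [])"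

lemma arc_coeff_neq_length: "length e \<noteq> length d \<Longrightarrow> arc_coeff e d st = 0"
  by (induction e d st rule: arc_coeff.induct) auto

text \<open>The inserted minus is pushed and popped at once, so what follows sees the same stack as
  without the pair. The stack is arbitrary because the prefix \<open>p\<close> may leave minuses
  open.\<close>

lemma arc_coeff_cup:
  "length p = length u \<Longrightarrow>
   arc_coeff (p @ False # True # q) (u @ a # b # w) st = cup_coeff a b * arc_coeff (p @ q) (u @ w) st"
proof (induction p u arbitrary: st rule: list_induct2)
  case (Cons x p y u)
  then show ?case by (cases x; cases st) auto
qed simp

lemma kl_cup:
  "length p = length u \<Longrightarrow>
   kl (p @ False # True # q) (u @ a # b # w) = cup_coeff a b * kl (p @ q) (u @ w)"
  by (simp add: kl_def arc_coeff_cup)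

text \<open>An arc has one plus in \<open>e\<close> and, where its weight is nonzero, one plus in
  \<open>d\<close>. The stack term counts the pluses of \<open>d\<close> already read at minuses of
  \<open>e\<close> that are still open.\<close>

lemma arc_coeff_plus_count:
  "arc_coeff e d st \<noteq> 0 \<Longrightarrow>
   length (filter id e) = length (filter id d) + length (filter id st)"
  by (induction e d st rule: arc_coeff.induct)
    (auto simp: cup_coeff_def filter_empty_conv split: if_splits)

lemma kl_Mspace:
  assumes "e \<in> Eset n k"
  shows "kl e \<in> Mspace n k"
  using assms arc_coeff_neq_length[of e _ "[]"] arc_coeff_plus_count[of e _ "[]"]
  by (fastforce simp: Mspace_def Eset_def kl_def)

section \<open>Unitriangularity and the off-diagonal entries\<close>

fun minus_code :: "bool list \<Rightarrow> nat" where
  "minus_code [] = 0"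
| "minus_code (x # d) = (if x then 0 else 2 ^ length d) + minus_code d"

text \<open>\<open>minus_code\<close> is a binary number with a bit 1 for each minus, so exchanging
  the signs of an arc moves a 1 to a lower place. A plus on the stack is an exchange under way: its
  minus comes later in \<open>d\<close>, with weight below \<open>2 ^ length d\<close>, which the
  extra term allows for.\<close>

lemma arc_coeff_minus_code:
  "arc_coeff e d st \<noteq> 0 \<Longrightarrow>
   d = e \<and> True \<notin> set st \<or> minus_code d < minus_code e + count_list st True * 2 ^ length d"
proof (induction e d st rule: arc_coeff.induct)
  case (1 st)
  then show ?case by (auto split: if_splits)
next
  case (4 e y d st)
  then have "length e = length d" using arc_coeff_neq_length by force
  with 4 show ?case by (cases y) auto
next
  case (5 e y d)
  then show ?case by (auto split: if_splits)
next
  case (6 e y d s st)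
  \<comment> \<open>\<open>M\<close> is the allowance left after the pop. A popped plus releases
    \<open>2 * 2 ^ length d\<close>, more than the bit \<open>2 ^ length d\<close> that
    \<open>d\<close> has here.\<close>
  define M where "M = count_list st True * 2 ^ length d"
  have "d = e \<and> True \<notin> set st \<or> minus_code d < minus_code e + M"
    using 6 by (simp add: M_def)
  moreover have "M = 0" if "True \<notin> set st"
    using that by (auto simp: M_def count_list_0_iff)
  moreover have "count_list (s # st) True * 2 ^ length (y # d)
      = 2 * M + (if s then 2 * 2 ^ length d else 0)"
    by (simp add: M_def algebra_simps)
  ultimately show ?case using 6(2)
    by (cases y; cases s) (auto simp del: count_list.simps)
qed auto

lemma kl_minus_code: "kl e d \<noteq> 0 \<Longrightarrow> d \<noteq> e \<Longrightarrow> minus_code d < minus_code e"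
  using arc_coeff_minus_code[of e d "[]"] by (auto simp: kl_def)

lemma arc_coeff_self: "True \<notin> set st \<Longrightarrow> arc_coeff e e st = 1"
proof (induction e arbitrary: st)
  case (Cons x e)
  then show ?case by (cases x; cases st) auto
qed simp

lemma kl_self [simp]: "kl e e = 1"
  by (simp add: kl_def arc_coeff_self)

text \<open>A nonzero coefficient is a product of factors -v over the exchanged arcs; a plus on the
  stack or a difference between \<open>d\<close> and \<open>e\<close> forces at least one such
  arc.\<close>

lemma arc_coeff_in_vZv: "d \<noteq> e \<or> True \<in> set st \<Longrightarrow> in_vZv (arc_coeff e d st)"
proof (induction e d st rule: arc_coeff.induct)
  case (6 e y d s st)
  show ?case
  proof (cases "s \<and> \<not> y")
    case True
    show ?thesis
    proof (cases "d \<noteq> e \<or> True \<in> set st")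
      case True
      with \<open>s \<and> \<not> y\<close> 6 show ?thesis by (simp add: in_vZv_minus in_vZv_mult)
    next
      case False
      with \<open>s \<and> \<not> y\<close> show ?thesis by (simp add: arc_coeff_self in_vZv_minus)
    qed
  next
    case False
    with 6 show ?thesis by (cases s; cases y) auto
  qed
qed auto

lemma kl_in_vZv: "in_vZv (kl e d - bvec e d)"
  using arc_coeff_in_vZv[of d e "[]"] by (auto simp: kl_def bvec_def arc_coeff_self)

text \<open>The dichotomy behind the inductions: an adjacent minus-plus can be removed or swapped,
  and without one there are no arcs; in \<open>Eset n k\<close> the sequence is then
  \<open>one_seq n k\<close>.\<close>

lemma no_cup_cases:
  obtains (cup) p q where "e = p @ False # True # q"
  | (sorted) a b where "e = replicate a True @ replicate b False"
proof -
  have "(\<exists>p q. e = p @ False # True # q) \<or> (\<exists>a b. e = replicate a True @ replicate b False)"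
  proof (induction e)
    case (Cons x e)
    then consider p q where "e = p @ False # True # q" |
      a b where "e = replicate a True @ replicate b False"
      by blast
    then show ?case
    proof cases
      case 1
      then show ?thesis by (metis append_Cons)
    next
      case (2 a b)
      show ?thesis
      proof (cases x)
        case True
        with 2 have "x # e = replicate (Suc a) True @ replicate b False" by simp
        then show ?thesis by blast
      next
        case False
        show ?thesis
        proof (cases a)
          case 0
          with 2 False have "x # e = replicate 0 True @ replicate (Suc b) False" by simp
          then show ?thesis by blast
        next
          case (Suc a')
          with 2 False have "x # e = [] @ False # True # replicate a' True @ replicate b False"
            by simp
          then show ?thesis by blast
        qed
      qed
    qed
  qed (rule disjI2, rule exI[of _ 0], rule exI[of _ 0], simp)
  with that show thesis by blast
qed

section \<open>Sequences without arcs, and caps applied to b_e\<close>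

lemma arc_coeff_minuses: "True \<notin> set e \<Longrightarrow> arc_coeff e d st = (if d = e \<and> True \<notin> set st then 1 else 0)"
  by (induction e d st rule: arc_coeff.induct) auto

text \<open>Without arcs nothing can be exchanged, and the sum over sets of arcs has one
  term.\<close>

lemma kl_sorted: "kl (replicate a True @ replicate b False) = bvec (replicate a True @ replicate b False)"
proof
  fix d
  show "kl (replicate a True @ replicate b False) d = bvec (replicate a True @ replicate b False) d"
  proof (induction a arbitrary: d)
    case 0
    then show ?case by (simp add: kl_def bvec_def arc_coeff_minuses)
  next
    case (Suc a)
    then show ?case by (cases d) (auto simp: kl_def bvec_def)
  qed
qed

lemma replicate_split_swap:
  "u @ True # False # w = replicate a True @ replicate b False \<longleftrightarrow>
   (\<exists>a' b'. a = Suc a' \<and> b = Suc b' \<and> u = replicate a' True \<and> w = replicate b' False)"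
proof (induction u arbitrary: a)
  case Nil
  then show ?case by (cases a; cases b; cases "a - 1") auto
next
  case (Cons x u)
  show ?case
  proof (cases a)
    case 0
    have "True \<in> set (x # u @ True # False # w)" by simp
    moreover have "True \<notin> set (replicate b False)" by simp
    ultimately show ?thesis using 0 by (metis append_Cons append_Nil nat.distinct(1) replicate_0)
  next
    case (Suc a')
    with Cons.IH[of a'] show ?thesis
      by (cases a') (auto simp: Cons_eq_append_conv)
  qed
qed

text \<open>The cap sends (+-) to 1, (-+) to -1/v and equal signs to 0. When all pluses come first,
  only a cap across the border between pluses and minuses survives; it deletes one sign of each
  kind. For \<open>c = 0\<close> the sequence \<open>e'\<close> carries no information, hence the
  guard on its length.\<close>

lemma kl_cap_sorted:
  "\<exists>c e'. c \<in> {0, 1} \<and> (c \<noteq> 0 \<longrightarrow> length e' + 2 = a + b) \<and>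
     (\<forall>u w. length u = i \<longrightarrow>
        kl (replicate a True @ replicate b False) (u @ True # False # w)
        - inverse vv * kl (replicate a True @ replicate b False) (u @ False # True # w) = c * kl e' (u @ w))"
proof -
  have 0: "bvec (replicate a True @ replicate b False) (u @ False # True # w) = 0" for u w
  proof -
    have "u @ False # True # w \<noteq> replicate a True @ replicate b False"
    proof
      assume eq: "u @ False # True # w = replicate a True @ replicate b False"
      \<comment> \<open>\<open>Not\<close> turns "pluses first" into ascending order of the
        booleans, which an adjacent minus-plus breaks.\<close>
      have "sorted (map Not (u @ False # True # w))"
        unfolding eq by (simp add: sorted_append)
      then show False by (simp add: sorted_append)
    qed
    then show ?thesis by (simp add: bvec_def)
  qed
  have "u @ True # False # w = replicate a True @ replicate b False \<longleftrightarrow>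
      i + 1 = a \<and> 0 < b \<and> u @ w = replicate (a - 1) True @ replicate (b - 1) False"
    if "length u = i" for u w
    unfolding replicate_split_swap using that
    by (auto simp: append_eq_append_conv gr0_conv_Suc)
  then have *: "bvec (replicate a True @ replicate b False) (u @ True # False # w) =
     (if i + 1 = a \<and> 0 < b then 1 else 0) * kl (replicate (a - 1) True @ replicate (b - 1) False) (u @ w)"
    if "length u = i" for u w
    using that by (simp add: kl_sorted bvec_def)
  show ?thesis
    by (rule exI[of _ "if i + 1 = a \<and> 0 < b then 1 else 0"],
        rule exI[of _ "replicate (a - 1) True @ replicate (b - 1) False"])
      (auto simp add: 0 * kl_sorted[of a b])
qed

lemma split_at_two:
  assumes "j + 2 \<le> length u"
  obtains u1 a b u2 where "u = u1 @ a # b # u2" "length u1 = j"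
proof
  show "u = take j u @ u ! j # u ! Suc j # drop (Suc (Suc j)) u"
    using assms by (simp add: Cons_nth_drop_Suc)
qed (use assms in simp)

text \<open>Capping off positions i and i + 1. When e has an arc between neighbouring positions j and
  j + 1, the cap slides past it if \<bar>i - j\<bar> \<ge> 2, straightens it to the identity if
  \<bar>i - j\<bar> = 1, and closes a loop if i = j.\<close>
lemma kl_cap:
  "\<exists>c e'. c \<in> {0, 1, - vv - inverse vv} \<and> (c \<noteq> 0 \<longrightarrow> length e' + 2 = length e) \<and>
     (\<forall>u w. length u = i \<longrightarrow>
        kl e (u @ True # False # w) - inverse vv * kl e (u @ False # True # w) = c * kl e' (u @ w))"
proof (induction e arbitrary: i rule: length_induct)
  case (1 e)
  show ?case
  proof (cases "i + 2 \<le> length e")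
    case False
    \<comment> \<open>The cap reaches past the end of \<open>e\<close>, so every list fed in is too
      long.\<close>
    then have "kl e (u @ a # b # w) = 0" if "length u = i" for u a b w
      using that by (simp add: kl_def arc_coeff_neq_length)
    then show ?thesis by (intro exI[of _ 0]) simp
  next
    case i: True
    show ?thesis
    proof (cases e rule: no_cup_cases)
      case (sorted a b)
      then show ?thesis using kl_cap_sorted[of a b i] by auto
    next
      case (cup p q)
      define j where "j = length p"
      have len: "length (p @ q) + 2 = length e" by (simp add: cup)
      have e: "kl e (u @ a # b # w) = cup_coeff a b * kl (p @ q) (u @ w)"
        if "length u = j" for u a b w
        using that kl_cup[of p u q a b w] by (simp add: cup j_def)
      consider "i = j" | "i = Suc j" | "j = Suc i" | "j + 2 \<le> i" | "i + 2 \<le> j" by linarith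
      then show ?thesis
      proof cases
        case 1
        \<comment> \<open>A closed loop: the two weights of the cup add up to -v - 1/v.\<close>
        show ?thesis
          by (rule exI[of _ "- vv - inverse vv"], rule exI[of _ "p @ q"])
            (simp add: e 1 len[simplified] algebra_simps)
      next
        case 2
        have "kl e (u @ True # False # w) - inverse vv * kl e (u @ False # True # w) = kl (p @ q) (u @ w)"
          if u: "length u = i" for u w
        proof -
          obtain u' c where u': "u = u' @ [c]" "length u' = j"
            using u 2 by (metis length_Suc_conv_rev)
          \<comment> \<open>The sign \<open>c\<close> at the free end of the cup decides which term
            survives: for a minus the first, with factor 1; for a plus the second, with factor
            (-1/v)(-v) = 1.\<close>
          show ?thesis
            using e[OF u'(2), of c True "False # w"] e[OF u'(2), of c False "True # w"]
            by (cases c) (simp_all add: u')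
        qed
        then show ?thesis using len by (intro exI[of _ 1] exI[of _ "p @ q"]) simp
      next
        case 3
        have "kl e (u @ True # False # w) - inverse vv * kl e (u @ False # True # w) = kl (p @ q) (u @ w)"
          if u: "length u = i" for u w
        proof (cases w)
          \<comment> \<open>The cup occupies positions i + 1 and i + 2, so an empty \<open>w\<close>
            makes the list too short for \<open>e\<close>.\<close>
          case Nil
          then show ?thesis
            using u 3 by (simp add: cup kl_def arc_coeff_neq_length j_def)
        next
          case (Cons c w')
          show ?thesis
            using u 3 e[of "u @ [True]" False c w'] e[of "u @ [False]" True c w']
            by (cases c) (simp_all add: Cons)
        qed
        then show ?thesis using len by (intro exI[of _ 1] exI[of _ "p @ q"]) simp
      next
        case 4
        have "length (p @ q) < length e" by (simp add: cup)
        \<comment> \<open>The cap is first applied to \<open>p @ q\<close>, two places further left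
          since the cup is gone; the cup is then put back at \<open>j\<close>.\<close>
        from "1.IH"[rule_format, OF this, of "i - 2"] obtain c e' where c: "c \<in> {0, 1, - vv - inverse vv}"
          and len': "c \<noteq> 0 \<Longrightarrow> length e' + 2 = length (p @ q)"
          and e': "\<And>u w. length u = i - 2 \<Longrightarrow> kl (p @ q) (u @ True # False # w)
            - inverse vv * kl (p @ q) (u @ False # True # w) = c * kl e' (u @ w)"
          by (elim exE conjE) blast
        define e'' where "e'' = take j e' @ False # True # drop j e'"
        have e'': "kl e'' (u @ a # b # w) = cup_coeff a b * kl e' (u @ w)"
          if "length u = j" "c \<noteq> 0" for u a b w
          using that kl_cup[of "take j e'" u "drop j e'" a b w] len len' i 4
          by (simp add: e''_def)
        have "kl e (u @ True # False # w) - inverse vv * kl e (u @ False # True # w) = c * kl e'' (u @ w)"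
          if u: "length u = i" for u w
        proof -
          obtain u1 a b u2 where u12: "u = u1 @ a # b # u2" "length u1 = j"
            using u 4 split_at_two by metis
          show ?thesis
            using e'[of "u1 @ u2" w] u u12 e[OF u12(2)] e''[OF u12(2)]
            by (cases "c = 0") (auto simp: algebra_simps simp flip: right_diff_distrib')
        qed
        then show ?thesis using c len len' by (intro exI[of _ c] exI[of _ e'']) (auto simp: e''_def)
      next
        case 5
        have "length (p @ q) < length e" by (simp add: cup)
        from "1.IH"[rule_format, OF this, of "i"] obtain c e' where c: "c \<in> {0, 1, - vv - inverse vv}"
          and len': "c \<noteq> 0 \<Longrightarrow> length e' + 2 = length (p @ q)"
          and e': "\<And>u w. length u = i \<Longrightarrow> kl (p @ q) (u @ True # False # w)
            - inverse vv * kl (p @ q) (u @ False # True # w) = c * kl e' (u @ w)"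
          by (elim exE conjE) blast
        \<comment> \<open>The cap has removed two signs to the left of the cup, which therefore goes
          back at \<open>j - 2\<close>.\<close>
        define e'' where "e'' = take (j - 2) e' @ False # True # drop (j - 2) e'"
        have e'': "kl e'' (u @ a # b # w) = cup_coeff a b * kl e' (u @ w)"
          if "length u = j - 2" "c \<noteq> 0" for u a b w
          using that kl_cup[of "take (j - 2) e'" u "drop (j - 2) e'" a b w] len len' i 5
          by (simp add: e''_def j_def)
        have len'': "c \<noteq> 0 \<Longrightarrow> length e'' + 2 = length e"
          using len len' by (simp add: e''_def)
        have "kl e (u @ True # False # w) - inverse vv * kl e (u @ False # True # w) = c * kl e'' (u @ w)"
          if u: "length u = i" for u w
        proof (cases "length u + length w + 2 = length e")
          case False
          then have "kl e (u @ a # b # w) = 0" "c \<noteq> 0 \<Longrightarrow> kl e'' (u @ w) = 0" for a b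
            using len'' by (simp_all add: kl_def arc_coeff_neq_length)
          then show ?thesis by (cases "c = 0") auto
        next
          case True
          define l where "l = j - 2 - i"
          \<comment> \<open>The correct total length makes \<open>w\<close> long enough to contain
            the cup.\<close>
          have "l + 2 \<le> length w" using u 5 True by (simp add: cup l_def j_def)
          then obtain w1 a b w2 where w12: "w = w1 @ a # b # w2" "length w1 = l"
            using split_at_two by metis
          have l: "length u + l + 2 = j" using u 5 by (simp add: l_def)
          show ?thesis
            using e'[of u "w1 @ w2"] u w12 l e[of "u @ True # False # w1" a b w2]
              e[of "u @ False # True # w1" a b w2] e''[of "u @ w1" a b w2]
            by (cases "c = 0") (auto simp: algebra_simps simp flip: right_diff_distrib')
        qed
        then show ?thesis using c len'' by (intro exI[of _ c] exI[of _ e'']) auto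
      qed
    qed
  qed
qed

section \<open>The bar involution of the module\<close>

lemma finite_Eset [simp]: "finite (Eset n k)"
  by (rule finite_subset[OF _ finite_lists_length_eq[of UNIV n]]) (auto simp: Eset_def)

lemma swp_append: "length u = i \<Longrightarrow> swp i (u @ a # b # w) = u @ b # a # w"
  by (simp add: swp_def nth_append list_update_append)

lemma Eset_length: "e \<in> Eset n k \<Longrightarrow> length e = n"
  by (simp add: Eset_def)

lemma Eset_swap: "u @ a # b # w \<in> Eset n k \<longleftrightarrow> u @ b # a # w \<in> Eset n k"
  by (auto simp: Eset_def)

lemma Mspace_eq_0: "m \<in> Mspace n k \<Longrightarrow> e \<notin> Eset n k \<Longrightarrow> m e = 0"
  by (simp add: Mspace_def)

lemma Mspace_add: "m \<in> Mspace n k \<Longrightarrow> m' \<in> Mspace n k \<Longrightarrow> (\<lambda>d. m d + m' d) \<in> Mspace n k"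
  and Mspace_diff: "m \<in> Mspace n k \<Longrightarrow> m' \<in> Mspace n k \<Longrightarrow> (\<lambda>d. m d - m' d) \<in> Mspace n k"
  and Mspace_smul: "m \<in> Mspace n k \<Longrightarrow> smul c m \<in> Mspace n k"
  and Mspace_bar: "m \<in> Mspace n k \<Longrightarrow> (\<lambda>d. bar_qv (m d)) \<in> Mspace n k"
  and Mspace_bvec: "e \<in> Eset n k \<Longrightarrow> bvec e \<in> Mspace n k"
  by (auto simp: Mspace_def smul_def bvec_def)

lemma T_basis_append:
  assumes "length u = i" "length u' = i"
  shows "T_basis i (u' @ x # y # w') (u @ a # b # w) =
    (if u' @ x # y # w' = u @ a # b # w then if a = b then vv else if a then 0 else vv - inverse vv else 0) +
    (if u' @ x # y # w' = u @ b # a # w then if a = b then 0 else 1 else 0)"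
  using assms
  by (cases a; cases b; cases x; cases y)
    (auto simp: T_basis_def nth_append swp_append smul_def bvec_def)

text \<open>T_i - v has rank one on the two signs at i and i + 1: it is the cap of
  \<open>kl_cap\<close> followed by the cup \<open>cup_coeff\<close>. In this form it can be
  composed with the arcs of b_e.\<close>

lemma T_act_append:
  assumes m: "m \<in> Mspace n k" and i: "i + 1 < n" "length u = i"
  shows "T_act n k i m (u @ a # b # w) = vv * m (u @ a # b # w) +
    cup_coeff a b * (m (u @ True # False # w) - inverse vv * m (u @ False # True # w))"
proof -
  \<comment> \<open>\<open>?D\<close> and \<open>?S\<close> are the entries of T_i in the row of
    \<open>?d\<close>. For equal signs \<open>?d\<close> and \<open>?d'\<close> coincide, and
    \<open>?S\<close> is 0 so that nothing is counted twice.\<close>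
  let ?D = "if a = b then vv else if a then 0 else vv - inverse vv"
  let ?S = "if a = b then 0 else 1 :: qv"
  let ?d = "u @ a # b # w" and ?d' = "u @ b # a # w"
  have *: "T_basis i e ?d = (if e = ?d then ?D else 0) + (if e = ?d' then ?S else 0)"
    if "e \<in> Eset n k" for e
  proof -
    have "i + 2 \<le> length e" using that i by (simp add: Eset_def)
    then obtain u' x y w' where u': "e = u' @ x # y # w'" "length u' = i"
      using split_at_two by metis
    show ?thesis unfolding u'(1) by (rule T_basis_append[OF i(2) u'(2)])
  qed
  have sums: "(\<Sum>e\<in>Eset n k. m e * ((if e = d then D else 0) + (if e = d' then S else 0))) = m d * D + m d' * S"
    for d d' and D S :: qv
  proof -
    have "m e * ((if e = d then D else 0) + (if e = d' then S else 0))
        = (if e = d then m e * D else 0) + (if e = d' then m e * S else 0)" for e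
      by (simp add: distrib_left)
    then show ?thesis using Mspace_eq_0[OF m] by (simp add: sum.distrib)
  qed
  have "T_act n k i m ?d = (\<Sum>e\<in>Eset n k. m e * ((if e = ?d then ?D else 0) + (if e = ?d' then ?S else 0)))"
    unfolding T_act_def by (intro sum.cong refl) (simp only: *)
  also have "\<dots> = m ?d * ?D + m ?d' * ?S"
    by (rule sums)
  also have "\<dots> = vv * m ?d + cup_coeff a b * (m (u @ True # False # w) - inverse vv * m (u @ False # True # w))"
    by (cases a; cases b) (simp_all add: algebra_simps)
  finally show ?thesis .
qed

lemma T_act_Mspace:
  assumes i: "i + 1 < n"
  shows "T_act n k i m \<in> Mspace n k"
proof -
  have "T_basis i e d = 0" if e: "e \<in> Eset n k" and d: "d \<notin> Eset n k" for e d
  proof -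
    have "i + 2 \<le> length e" using e i by (simp add: Eset_def)
    then obtain u x y w where u: "e = u @ x # y # w" "length u = i"
      using split_at_two by metis
    then have "swp i e \<in> Eset n k"
      using e Eset_swap by (simp add: swp_append)
    with e d have "d \<noteq> e" "d \<noteq> swp i e" by auto
    then show ?thesis by (simp add: T_basis_def smul_def bvec_def)
  qed
  then show ?thesis by (simp add: Mspace_def T_act_def)
qed

text \<open>By \<open>kl_cap\<close> the cap turns b_e into a bar-invariant multiple of some b_e0;
  the cup in \<open>T_act_append\<close> then inserts an adjacent minus-plus into e0 at i.\<close>

lemma T_act_kl:
  assumes e: "e \<in> Eset n k" and i: "i + 1 < n"
  obtains c e' where "bar_qv c = c" "e' \<in> Eset n k"
    "T_act n k i (kl e) = (\<lambda>d. vv * kl e d + c * kl e' d)"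
proof -
  have M: "T_act n k i (kl e) \<in> Mspace n k"
    by (rule T_act_Mspace[OF i])
  obtain c e0 where c: "c \<in> {0, 1, - vv - inverse vv}"
    and len: "c \<noteq> 0 \<Longrightarrow> length e0 + 2 = length e"
    and cap: "\<And>u w. length u = i \<Longrightarrow>
      kl e (u @ True # False # w) - inverse vv * kl e (u @ False # True # w) = c * kl e0 (u @ w)"
    using kl_cap[of e i] by (elim exE conjE) blast
  have "bar_qv c = c" using c by auto
  define e' where "e' = take i e0 @ False # True # drop i e0"
  have T: "T_act n k i (kl e) = (\<lambda>d. vv * kl e d + c * kl e' d)"
  proof
    fix d
    show "T_act n k i (kl e) d = vv * kl e d + c * kl e' d"
    proof (cases "length d = n")
      case True
      with i have "i + 2 \<le> length d" by simp
      then obtain u a b w where d: "d = u @ a # b # w" "length u = i"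
        using split_at_two by metis
      have "c * kl e' d = c * (cup_coeff a b * kl e0 (u @ w))"
      proof (cases "c = 0")
        case False
        then have "length (take i e0) = length u"
          using len e i d by (simp add: Eset_length)
        then show ?thesis using kl_cup[of "take i e0" u "drop i e0" a b w]
          by (simp add: e'_def d)
      qed simp
      then show ?thesis
        using T_act_append[OF kl_Mspace[OF e] i d(2)] cap[OF d(2)] by (auto simp: d)
    next
      case False
      then have "d \<notin> Eset n k" "kl e d = 0" "c \<noteq> 0 \<Longrightarrow> kl e' d = 0"
        using e len by (auto simp: kl_def e'_def Eset_length intro!: arc_coeff_neq_length)
      then show ?thesis using Mspace_eq_0[OF M] by auto
    qed
  qed
  show thesis
  proof (cases "e' \<in> Eset n k")
    case True
    with that T \<open>bar_qv c = c\<close> show thesis by blast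
  next
    case False
    \<comment> \<open>For \<open>e'\<close> outside \<open>Eset n k\<close>, the coefficient at
      \<open>e'\<close> itself, where \<open>kl e'\<close> is 1, forces the second term to be 0;
      \<open>e\<close> with coefficient 0 then serves instead.\<close>
    have "c * kl e' e' = 0"
      using Mspace_eq_0[OF M False] Mspace_eq_0[OF kl_Mspace[OF e] False] by (simp add: T)
    then show thesis using that[of 0 e] T e by simp
  qed
qed

section \<open>Generation of M' by \<open>one_seq\<close>, and uniqueness of the bar
  involution\<close>

lemma minus_code_swap: "minus_code (p @ True # False # q) < minus_code (p @ False # True # q)"
  by (induction p) auto

lemma bvec_T_act:
  assumes e: "p @ False # True # q \<in> Eset n k"
  shows "bvec (p @ False # True # q) = T_act n k (length p) (bvec (p @ True # False # q))"
proof
  fix d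
  have e': "p @ True # False # q \<in> Eset n k" using e Eset_swap by blast
  have "T_act n k (length p) (bvec (p @ True # False # q)) d = T_basis (length p) (p @ True # False # q) d"
  proof -
    have "T_act n k (length p) (bvec (p @ True # False # q)) d =
       (\<Sum>c\<in>Eset n k. if c = p @ True # False # q then T_basis (length p) c d else 0)"
      unfolding T_act_def by (intro sum.cong) (auto simp: bvec_def)
    then show ?thesis using e' by simp
  qed
  also have "\<dots> = bvec (p @ False # True # q) d"
    by (simp add: T_basis_def nth_append swp_append)
  finally show "bvec (p @ False # True # q) d = T_act n k (length p) (bvec (p @ True # False # q)) d" ..
qed

text \<open>M' is generated by the basis vector of \<open>one_seq n k\<close>: a sequence with an
  adjacent minus-plus arises by T_i from the one with this pair swapped, whose
  \<open>minus_code\<close> is smaller. Sums and multiples then give all of M'.\<close>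

lemma Mspace_T_induct:
  assumes m: "m \<in> Mspace n k" and k: "k \<le> n"
    and one: "P (bvec (one_seq n k))"
    and add: "\<And>m m'. m \<in> Mspace n k \<Longrightarrow> m' \<in> Mspace n k \<Longrightarrow> P m \<Longrightarrow> P m' \<Longrightarrow> P (\<lambda>d. m d + m' d)"
    and smul: "\<And>c m. m \<in> Mspace n k \<Longrightarrow> P m \<Longrightarrow> P (smul c m)"
    and T: "\<And>i m. i + 1 < n \<Longrightarrow> m \<in> Mspace n k \<Longrightarrow> P m \<Longrightarrow> P (T_act n k i m)"
  shows "P m"
proof -
  have basis: "P (bvec e)" if "e \<in> Eset n k" for e
    using that
  proof (induction e rule: measure_induct_rule[of minus_code])
    case (less e)
    show ?case
    proof (cases e rule: no_cup_cases)
      case (cup p q)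
      have e': "p @ True # False # q \<in> Eset n k"
        using less.prems cup Eset_swap by blast
      then have "P (bvec (p @ True # False # q))"
        using less.IH minus_code_swap cup by blast
      moreover have "length p + 1 < n"
        using less.prems cup by (auto simp: Eset_def)
      ultimately show ?thesis
        using T[OF _ Mspace_bvec[OF e'], of "length p"] less.prems bvec_T_act cup by metis
    next
      case (sorted a b)
      with less.prems have "a = k" "b = n - k" by (auto simp: Eset_def)
      with sorted one show ?thesis by (simp add: one_seq_def)
    qed
  qed
  have one_E: "one_seq n k \<in> Eset n k"
    using k by (simp add: one_seq_def Eset_def)
  have "P (\<lambda>d. \<Sum>e\<in>A. m e * bvec e d) \<and> (\<lambda>d. \<Sum>e\<in>A. m e * bvec e d) \<in> Mspace n k"
    if "finite A" "A \<subseteq> Eset n k" for A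
    using that
  proof (induction A)
    case empty
    \<comment> \<open>The empty sum is obtained as the zero multiple of the generator.\<close>
    have "smul 0 (bvec (one_seq n k)) = (\<lambda>d. 0)" by (simp add: smul_def)
    then show ?case
      using smul[OF Mspace_bvec[OF one_E] one, of 0] by (simp add: Mspace_def)
  next
    case (insert e A)
    then show ?case
      using add[OF Mspace_smul[OF Mspace_bvec[of e n k]] _ smul[OF _ basis[of e]], of _ "m e"]
        Mspace_add[OF Mspace_smul[OF Mspace_bvec[of e n k], of "m e"]]
      by (simp add: smul_def Mspace_bvec)
  qed
  from this[of "Eset n k"] have "P (\<lambda>d. \<Sum>e\<in>Eset n k. m e * bvec e d)" by simp
  also have "(\<lambda>d. \<Sum>e\<in>Eset n k. m e * bvec e d) = m"
    using Mspace_eq_0[OF m] by (auto simp: bvec_def if_distrib cong: if_cong)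
  finally show ?thesis .
qed

text \<open>Both maps agree at the generator and obey the same rules for sums, multiples and
  T_i.\<close>

lemma is_bar_M_unique:
  assumes "is_bar_M n k \<beta>" "is_bar_M n k \<beta>'" "k \<le> n" "m \<in> Mspace n k"
  shows "\<beta> m = \<beta>' m"
  using assms(4,3)
proof (rule Mspace_T_induct)
  show "\<beta> (bvec (one_seq n k)) = \<beta>' (bvec (one_seq n k))"
    using assms by (simp add: is_bar_M_def)
qed (use assms in \<open>simp_all add: is_bar_M_def\<close>)

section \<open>The b_e as a basis of M'\<close>

definition kl_comb :: "nat \<Rightarrow> nat \<Rightarrow> mod_elt \<Rightarrow> mod_elt" where
  "kl_comb n k c = (\<lambda>d. \<Sum>e\<in>Eset n k. c e * kl e d)"

lemma kl_comb_Mspace: "kl_comb n k c \<in> Mspace n k"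
  using kl_Mspace by (auto simp: kl_comb_def Mspace_def intro!: sum.neutral)

lemma kl_comb_add: "kl_comb n k (\<lambda>d. c d + c' d) = (\<lambda>d. kl_comb n k c d + kl_comb n k c' d)"
  by (simp add: kl_comb_def sum.distrib distrib_right)

lemma kl_comb_diff: "kl_comb n k (\<lambda>d. c d - c' d) = (\<lambda>d. kl_comb n k c d - kl_comb n k c' d)"
  by (simp add: kl_comb_def sum_subtractf left_diff_distrib)

lemma kl_comb_smul: "kl_comb n k (smul a c) = smul a (kl_comb n k c)"
  by (simp add: kl_comb_def smul_def sum_distrib_left mult.assoc)

lemma kl_comb_bvec:
  assumes "e \<in> Eset n k"
  shows "kl_comb n k (bvec e) = kl e"
proof
  fix d
  have "kl_comb n k (bvec e) d = (\<Sum>e'\<in>Eset n k. if e' = e then kl e d else 0)"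
    unfolding kl_comb_def by (intro sum.cong) (auto simp: bvec_def)
  then show "kl_comb n k (bvec e) d = kl e d" using assms by simp
qed

text \<open>Take \<open>d\<close> of largest \<open>minus_code\<close> in the support of
  \<open>c\<close>. By triangularity no other \<open>kl e\<close> with \<open>c e\<close> nonzero
  reaches \<open>d\<close>, and \<open>kl d d\<close> is 1.\<close>

lemma kl_comb_leading:
  assumes c: "c \<in> Mspace n k" "c \<noteq> (\<lambda>d. 0)"
  obtains d where "d \<in> Eset n k" "c d \<noteq> 0" "kl_comb n k c d = c d"
proof -
  define S where "S = {d \<in> Eset n k. c d \<noteq> 0}"
  have "finite S" by (simp add: S_def)
  moreover have "S \<noteq> {}" using c by (fastforce simp: S_def Mspace_def fun_eq_iff)
  ultimately obtain d where d: "d \<in> S" "\<And>e. e \<in> S \<Longrightarrow> minus_code e \<le> minus_code d"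
    using finite_has_maximal[of "minus_code ` S"] by (metis (no_types, lifting) Max_ge Max_in finite_imageI image_iff image_is_empty)
  have "c e = 0 \<or> kl e d = 0" if "e \<in> Eset n k" "e \<noteq> d" for e
  proof (rule ccontr)
    assume "\<not> (c e = 0 \<or> kl e d = 0)"
    then have "e \<in> S" "minus_code d < minus_code e"
      using that kl_minus_code[of e d] by (auto simp: S_def)
    then show False using d(2)[of e] by simp
  qed
  then have "kl_comb n k c d = (\<Sum>e\<in>Eset n k. if e = d then c d else 0)"
    unfolding kl_comb_def by (intro sum.cong) auto
  with d show thesis by (intro that[of d]) (auto simp: S_def)
qed

lemma kl_comb_inj:
  assumes "c \<in> Mspace n k" "c' \<in> Mspace n k" "kl_comb n k c = kl_comb n k c'"
  shows "c = c'"
proof (rule ccontr)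
  assume "c \<noteq> c'"
  then have "(\<lambda>d. c d - c' d) \<noteq> (\<lambda>d. 0)" by (metis eq_iff_diff_eq_0 ext)
  then obtain d where "c d - c' d \<noteq> 0" "kl_comb n k (\<lambda>d. c d - c' d) d = c d - c' d"
    using kl_comb_leading[OF Mspace_diff[OF assms(1,2)]] by metis
  then show False using assms(3) by (simp add: kl_comb_diff)
qed

text \<open>In the basis b_e the operator T_i is v + \<open>U\<close>, where the matrix of
  \<open>U\<close> has bar-invariant entries. That \<open>U\<close> commutes with the bar of
  coefficients is what later turns T_i into its inverse.\<close>

lemma T_act_kl_comb:
  assumes i: "i + 1 < n"
  shows "\<exists>U. (\<forall>c. U c \<in> Mspace n k) \<and> (\<forall>c. U (\<lambda>d. bar_qv (c d)) = (\<lambda>d. bar_qv (U c d))) \<and>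
    (\<forall>c. T_act n k i (kl_comb n k c) = kl_comb n k (\<lambda>d. vv * c d + U c d))"
proof -
  have "\<exists>a e'. bar_qv a = a \<and> e' \<in> Eset n k \<and> T_act n k i (kl e) = (\<lambda>d. vv * kl e d + a * kl e' d)"
    if "e \<in> Eset n k" for e
    using T_act_kl[OF that i] by metis
  then obtain a f where af: "\<And>e. e \<in> Eset n k \<Longrightarrow> bar_qv (a e) = a e"
    "\<And>e. e \<in> Eset n k \<Longrightarrow> f e \<in> Eset n k"
    "\<And>e. e \<in> Eset n k \<Longrightarrow> T_act n k i (kl e) = (\<lambda>d. vv * kl e d + a e * kl (f e) d)"
    by metis
  \<comment> \<open>The index map \<open>f\<close> may fail to be injective, so \<open>U\<close>
    collects coefficients over its fibres.\<close>
  define U where "U c d = (\<Sum>e | e \<in> Eset n k \<and> f e = d. c e * a e)" for c d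
  have "U c \<in> Mspace n k" for c
    using af(2) by (auto simp: Mspace_def U_def intro!: sum.neutral)
  moreover have "U (\<lambda>d. bar_qv (c d)) = (\<lambda>d. bar_qv (U c d))" for c
    using af(1) by (auto simp: U_def intro!: sum.cong)
  moreover have "T_act n k i (kl_comb n k c) = kl_comb n k (\<lambda>d. vv * c d + U c d)" for c
  proof
    fix d
    have "T_act n k i (kl_comb n k c) d = (\<Sum>e\<in>Eset n k. c e * T_act n k i (kl e) d)"
      unfolding T_act_def kl_comb_def sum_distrib_left sum_distrib_right
      by (subst sum.swap) (simp add: mult.assoc)
    also have "\<dots> = (\<Sum>e\<in>Eset n k. vv * c e * kl e d) + (\<Sum>e\<in>Eset n k. c e * a e * kl (f e) d)"
      by (simp add: af(3) algebra_simps flip: sum.distrib)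
    also have "(\<Sum>e\<in>Eset n k. c e * a e * kl (f e) d) =
        (\<Sum>e'\<in>Eset n k. \<Sum>e | e \<in> Eset n k \<and> f e = e'. c e * a e * kl (f e) d)"
      using af(2) by (intro sum.group[symmetric]) auto
    also have "\<dots> = (\<Sum>e'\<in>Eset n k. U c e' * kl e' d)"
      unfolding U_def sum_distrib_right by (intro sum.cong) auto
    finally show "T_act n k i (kl_comb n k c) d = kl_comb n k (\<lambda>d. vv * c d + U c d) d"
      by (simp add: kl_comb_def algebra_simps flip: sum.distrib)
  qed
  ultimately show ?thesis by (intro exI[of _ U] conjI allI)
qed

lemma one_seq_Eset: "k \<le> n \<Longrightarrow> one_seq n k \<in> Eset n k"
  by (simp add: one_seq_def Eset_def)

text \<open>The span of the b_e contains the generator, which is the b of a sequence without arcs,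
  and is stable under every T_i by \<open>T_act_kl_comb\<close>; hence it is all of M'.\<close>

lemma kl_comb_surj:
  assumes "m \<in> Mspace n k" "k \<le> n"
  obtains c where "c \<in> Mspace n k" "m = kl_comb n k c"
proof -
  from assms have "\<exists>c\<in>Mspace n k. m = kl_comb n k c"
  proof (rule Mspace_T_induct)
    have "bvec (one_seq n k) = kl (one_seq n k)"
      by (simp add: one_seq_def kl_sorted)
    then show "\<exists>c\<in>Mspace n k. bvec (one_seq n k) = kl_comb n k c"
      using Mspace_bvec kl_comb_bvec one_seq_Eset assms(2) by metis
  next
    fix m m' assume "\<exists>c\<in>Mspace n k. m = kl_comb n k c" "\<exists>c\<in>Mspace n k. m' = kl_comb n k c"
    then obtain c c' where "c \<in> Mspace n k" "m = kl_comb n k c" "c' \<in> Mspace n k" "m' = kl_comb n k c'"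
      by blast
    then show "\<exists>c\<in>Mspace n k. (\<lambda>d. m d + m' d) = kl_comb n k c"
      by (intro bexI[of _ "\<lambda>d. c d + c' d"]) (simp_all add: kl_comb_add Mspace_add)
  next
    fix a m assume "\<exists>c\<in>Mspace n k. m = kl_comb n k c"
    then obtain c where "c \<in> Mspace n k" "m = kl_comb n k c" by blast
    then show "\<exists>c\<in>Mspace n k. smul a m = kl_comb n k c"
      by (intro bexI[of _ "smul a c"]) (simp_all add: kl_comb_smul Mspace_smul)
  next
    fix i m assume i: "i + 1 < n" and "\<exists>c\<in>Mspace n k. m = kl_comb n k c"
    then obtain c where c: "c \<in> Mspace n k" "m = kl_comb n k c" by blast
    obtain U where "\<forall>c. U c \<in> Mspace n k" "\<forall>c. U (\<lambda>d. bar_qv (c d)) = (\<lambda>d. bar_qv (U c d))"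
      "\<forall>c. T_act n k i (kl_comb n k c) = kl_comb n k (\<lambda>d. vv * c d + U c d)"
      using T_act_kl_comb[OF i, of k] by (elim exE conjE) (rule that)
    then show "\<exists>c\<in>Mspace n k. T_act n k i m = kl_comb n k c"
      using Mspace_add[OF Mspace_smul[OF c(1), of vv, unfolded smul_def], of "U c"] c(2)
      by (intro bexI[of _ "\<lambda>d. vv * c d + U c d"]) simp_all
  qed
  with that show thesis by blast
qed

section \<open>The semilinear map fixing every b_e\<close>

definition kl_bar :: "nat \<Rightarrow> nat \<Rightarrow> mod_elt \<Rightarrow> mod_elt" where
  "kl_bar n k m = kl_comb n k (\<lambda>e. bar_qv ((THE c. c \<in> Mspace n k \<and> m = kl_comb n k c) e))"

text \<open>Coordinates are unique by \<open>kl_comb_inj\<close>, so the description in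
  \<open>kl_bar\<close> picks \<open>c\<close>.\<close>

lemma kl_bar_comb: "c \<in> Mspace n k \<Longrightarrow> kl_bar n k (kl_comb n k c) = kl_comb n k (\<lambda>e. bar_qv (c e))"
proof -
  assume "c \<in> Mspace n k"
  then have "(THE c'. c' \<in> Mspace n k \<and> kl_comb n k c = kl_comb n k c') = c"
    using kl_comb_inj by (intro the_equality) auto
  then show ?thesis by (simp add: kl_bar_def)
qed

lemma kl_bar_kl: "e \<in> Eset n k \<Longrightarrow> kl_bar n k (kl e) = kl e"
  using kl_bar_comb[OF Mspace_bvec[of e n k]]
  by (simp add: kl_comb_bvec bvec_def if_distrib cong: if_cong) (simp add: kl_comb_bvec flip: bvec_def)

lemma is_bar_M_kl_bar:
  assumes k: "k \<le> n"
  shows "is_bar_M n k (kl_bar n k)"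
  unfolding is_bar_M_def
proof (intro conjI ballI allI impI)
  fix m show "kl_bar n k m \<in> Mspace n k"
    by (simp add: kl_bar_def kl_comb_Mspace)
next
  fix m m' assume "m \<in> Mspace n k" "m' \<in> Mspace n k"
  then obtain c c' where "c \<in> Mspace n k" "m = kl_comb n k c" "c' \<in> Mspace n k" "m' = kl_comb n k c'"
    using kl_comb_surj k by metis
  then show "kl_bar n k (\<lambda>d. m d + m' d) = (\<lambda>d. kl_bar n k m d + kl_bar n k m' d)"
    using kl_bar_comb[OF Mspace_add, of c n k c'] by (simp add: kl_bar_comb kl_comb_add)
next
  fix a m assume "m \<in> Mspace n k"
  then obtain c where "c \<in> Mspace n k" "m = kl_comb n k c"
    using kl_comb_surj k by metis
  moreover have "kl_comb n k (\<lambda>e. bar_qv (smul a c e)) = kl_comb n k (smul (bar_qv a) (\<lambda>e. bar_qv (c e)))"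
    by (simp add: smul_def)
  ultimately show "kl_bar n k (smul a m) = smul (bar_qv a) (kl_bar n k m)"
    using kl_bar_comb[OF Mspace_smul, of c n k a] by (simp add: kl_bar_comb kl_comb_smul)
next
  show "kl_bar n k (bvec (one_seq n k)) = bvec (one_seq n k)"
    using kl_bar_kl[OF one_seq_Eset[OF k]] by (simp add: one_seq_def kl_sorted)
next
  fix i m assume i: "i + 1 < n" and "m \<in> Mspace n k"
  then obtain c where c: "c \<in> Mspace n k" "m = kl_comb n k c"
    using kl_comb_surj k by metis
  obtain U where U: "\<forall>c. U c \<in> Mspace n k" "\<forall>c. U (\<lambda>d. bar_qv (c d)) = (\<lambda>d. bar_qv (U c d))"
      "\<forall>c. T_act n k i (kl_comb n k c) = kl_comb n k (\<lambda>d. vv * c d + U c d)"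
    using T_act_kl_comb[OF i, of k] by (elim exE conjE) (rule that)
  have smul: "kl_comb n k (\<lambda>d. a * c d) = (\<lambda>d. a * kl_comb n k c d)" for a c
    using kl_comb_smul[of n k a c] by (simp add: smul_def)
  have "kl_bar n k (T_act n k i m) = kl_comb n k (\<lambda>d. bar_qv (vv * c d + U c d))"
    using kl_bar_comb[OF Mspace_add[OF Mspace_smul[OF c(1), of vv, unfolded smul_def] U(1)[rule_format, of c]]]
    by (simp add: c U)
  \<comment> \<open>The inverse of T_i is T_i - v + 1/v, so in coordinates it acts as 1/v +
    \<open>U\<close>; the bar of v \<open>c\<close> + \<open>U c\<close> is exactly this applied to
    the bar of \<open>c\<close>.\<close>
  also have "\<dots> = Tinv_act n k i (kl_comb n k (\<lambda>d. bar_qv (c d)))"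
    by (simp add: Tinv_act_def U kl_comb_add smul algebra_simps)
  finally show "kl_bar n k (T_act n k i m) = Tinv_act n k i (kl_bar n k m)"
    by (simp add: c kl_bar_comb)
qed

text \<open>\<open>bar_M\<close> is some map satisfying the axioms; \<open>kl_bar\<close> shows that
  one exists, and on \<open>Mspace n k\<close> its values are determined.\<close>

lemma bar_M_eq_kl_bar:
  assumes "k \<le> n" "m \<in> Mspace n k"
  shows "bar_M n k m = kl_bar n k m"
proof -
  have "is_bar_M n k (bar_M n k)"
    unfolding bar_M_def
    by (rule someI[of "is_bar_M n k"], rule is_bar_M_kl_bar[OF assms(1)])
  then show ?thesis
    using is_bar_M_unique is_bar_M_kl_bar assms by blast
qed

text \<open>The coordinates of a competitor \<open>C\<close> are bar-invariant. The leading
  coordinate of \<open>C\<close> - b_e is also a coefficient of \<open>C\<close> - b_e, hence lies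
  in v Z[v], and so would have to vanish.\<close>

lemma KL_elt_eq_kl:
  assumes k: "k \<le> n" and e: "e \<in> Eset n k"
  shows "KL_elt n k e = kl e"
  unfolding KL_elt_def
proof (rule the_equality)
  show "kl e \<in> Mspace n k \<and> bar_M n k (kl e) = kl e \<and> (\<forall>d\<in>Eset n k. in_vZv (kl e d - bvec e d))"
    using e k by (simp add: kl_Mspace bar_M_eq_kl_bar kl_bar_kl kl_in_vZv)
next
  fix C assume C: "C \<in> Mspace n k \<and> bar_M n k C = C \<and> (\<forall>d\<in>Eset n k. in_vZv (C d - bvec e d))"
  then obtain c where c: "c \<in> Mspace n k" "C = kl_comb n k c"
    using kl_comb_surj k by metis
  have "kl_bar n k C = C"
    using C k bar_M_eq_kl_bar by metis
  then have "kl_comb n k (\<lambda>d. bar_qv (c d)) = kl_comb n k c"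
    using c by (simp add: kl_bar_comb)
  then have bar: "(\<lambda>d. bar_qv (c d)) = c"
    using kl_comb_inj Mspace_bar c by blast
  have "c = bvec e"
  proof (rule ccontr)
    assume "c \<noteq> bvec e"
    then have "(\<lambda>d. c d - bvec e d) \<noteq> (\<lambda>d. 0)" by (metis eq_iff_diff_eq_0 ext)
    then obtain d where d: "d \<in> Eset n k" "c d - bvec e d \<noteq> 0"
      "kl_comb n k (\<lambda>d. c d - bvec e d) d = c d - bvec e d"
      using kl_comb_leading[OF Mspace_diff[OF c(1) Mspace_bvec[OF e]]] by metis
    \<comment> \<open>Both \<open>C\<close> and \<open>kl e\<close> are congruent to
      \<open>bvec e\<close> modulo v Z[v].\<close>
    have "in_vZv ((C d - bvec e d) - (kl e d - bvec e d))"
      using C d(1) kl_in_vZv in_vZv_diff by blast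
    then have "in_vZv (c d - bvec e d)"
      using d(3) c e by (simp add: kl_comb_diff kl_comb_bvec)
    moreover have "bar_qv (c d - bvec e d) = c d - bvec e d"
      using fun_cong[OF bar, of d] by (simp add: bvec_def)
    ultimately show False using d(2) in_vZv_bar_fixed by blast
  qed
  then show "C = kl e" using c e by (simp add: kl_comb_bvec)
qed

section \<open>Comparison with the product formula\<close>

lemma Cst_mult: "Cst (a * b) = Cst a * Cst b"
  by (simp add: Cst_def mult_single)

lemma Cst_simps [simp]: "Cst 0 = 0" "Cst 1 = 1"
  by (simp_all add: Cst_def)

lemma Cst_minus: "Cst (- a) = - Cst a"
  by (simp add: Cst_def single_uminus)

text \<open>In the rescaled variables the factor of an arc (i, j) becomes Yv i - v Yv j, whatever its length.\<close>
definition Yv :: "nat \<Rightarrow> mpoly" where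
  "Yv i = Cst (vv ^ i) * Xv i"

fun minus_prod :: "bool list \<Rightarrow> nat \<Rightarrow> mpoly" where
  "minus_prod [] p = 1"
| "minus_prod (x # d) p = (if x then 1 else Yv p) * minus_prod d (Suc p)"

fun minus_sum :: "bool list \<Rightarrow> nat \<Rightarrow> nat" where
  "minus_sum [] p = 0"
| "minus_sum (x # d) p = (if x then 0 else p) + minus_sum d (Suc p)"

text \<open>The number of pluses is left free so that sums split by the first sign; in a sum
  weighted by \<open>kl e\<close>, sequences with another number of pluses than \<open>e\<close>
  have coefficient 0.\<close>

definition blists :: "nat \<Rightarrow> bool list set" where
  "blists m = {d. length d = m}"

lemma finite_blists [simp]: "finite (blists m)"
  using finite_lists_length_eq[of "UNIV :: bool set" m] by (simp add: blists_def)

lemma sum_blists_0 [simp]: "(\<Sum>d\<in>blists 0. f d) = f []"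
  by (simp add: blists_def)

lemma sum_blists_Suc [simp]:
  "(\<Sum>d\<in>blists (Suc m). f d) = (\<Sum>d\<in>blists m. f (False # d)) + (\<Sum>d\<in>blists m. f (True # d))"
proof -
  have "blists (Suc m) = Cons False ` blists m \<union> Cons True ` blists m"
    by (auto simp: blists_def length_Suc_conv image_iff)
  moreover have "Cons False ` blists m \<inter> Cons True ` blists m = {}" by auto
  ultimately show ?thesis
    by (simp add: sum.union_disjoint sum.reindex inj_on_def)
qed

text \<open>\<open>st\<close> holds the positions of the open minuses of \<open>e\<close> and
  \<open>s\<close> the entries of \<open>d\<close> there, so this is the part of the monomial of
  \<open>d\<close> at the open positions.\<close>

fun stack_prod :: "bool list \<Rightarrow> nat list \<Rightarrow> mpoly" where
  "stack_prod (x # s) (i # st) = (if x then 1 else Yv i) * stack_prod s st"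
| "stack_prod _ _ = 1"

lemma stack_prod_minuses:
  "(\<Sum>s\<in>blists (length st). stack_prod s st * Cst (if True \<in> set s then 0 else 1)) = (\<Prod>i\<leftarrow>st. Yv i)"
proof (induction st)
  case (Cons i st)
  then show ?case by (simp add: mult.assoc flip: sum_distrib_left)
qed simp

definition arcs_prod :: "(nat \<times> nat) list \<times> nat list \<Rightarrow> mpoly" where
  "arcs_prod r = (\<Prod>(i, j)\<leftarrow>fst r. Yv i - Cst vv * Yv j) * (\<Prod>i\<leftarrow>snd r. Yv i)"

text \<open>Induction along the matching, summing over all entries at the minuses still open. When
  an arc (i, p) closes, its entries (-+) give Y_i and (+-) give -v Y_p, so it contributes Y_i - v
  Y_p. Minuses never closed keep their sign, by \<open>stack_prod_minuses\<close>.\<close>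

lemma arc_generating:
  "(\<Sum>s\<in>blists (length st). \<Sum>d\<in>blists (length e).
      stack_prod s st * Cst (arc_coeff e d s) * minus_prod d p) = arcs_prod (match_aux e p st)"
proof (induction e p st rule: match_aux.induct)
  case (1 p st)
  then show ?case using stack_prod_minuses[of st]
    by (simp add: arcs_prod_def)
next
  case (2 xs p st)
  then show ?case
    by (simp add: algebra_simps sum.distrib)
next
  case (3 xs p)
  then show ?case by simp
next
  case (4 xs p i st)
  let ?g = "\<lambda>s d. stack_prod s st * Cst (arc_coeff xs d s) * minus_prod d (Suc p)"
  have "arcs_prod (match_aux (True # xs) p (i # st)) =
      (Yv i - Cst vv * Yv p) * arcs_prod (match_aux xs (Suc p) st)"
    by (simp add: arcs_prod_def Let_def mult.assoc)
  also have "\<dots> = (\<Sum>s\<in>blists (length st). \<Sum>d\<in>blists (length xs). Yv i * ?g s d - Cst vv * Yv p * ?g s d)"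
    unfolding 4[symmetric] sum_distrib_left by (simp add: left_diff_distrib)
  finally show ?case
    by (simp add: algebra_simps sum.distrib sum_subtractf Cst_mult Cst_minus sum_negf)
qed

text \<open>The exponent adds up the positions of the minuses still to be read and of those on the
  stack. The share v^i of a minus at i rescales its whole factor, including the second term if it is
  paired.\<close>

lemma Qpoly_rescale:
  "(\<And>i. i \<in> set st \<Longrightarrow> i < p) \<Longrightarrow>
   (let r = match_aux e p st in Cst (vv ^ (minus_sum e p + sum_list st)) *
     (\<Prod>(i, j)\<leftarrow>fst r. Xv i - Cst (vv ^ (j + 1 - i)) * Xv j) * (\<Prod>i\<leftarrow>snd r. Xv i))
   = arcs_prod (match_aux e p st)"
proof (induction e p st rule: match_aux.induct)
  case (1 p st)
  have "Cst (vv ^ sum_list st) * (\<Prod>i\<leftarrow>st. Xv i) = (\<Prod>i\<leftarrow>st. Yv i)" for st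
    by (induction st) (simp_all add: Yv_def power_add Cst_mult ac_simps)
  then show ?case by (simp add: arcs_prod_def)
next
  case (2 xs p st)
  have "i < Suc p" if "i \<in> set (p # st)" for i
    using that 2(2)[of i] by auto
  from 2(1)[OF this] show ?case by (simp add: ac_simps)
next
  case (3 xs p)
  then show ?case by simp
next
  case (4 xs p i st)
  have *: "Yv i - Cst vv * Yv p = Cst (vv ^ i) * (Xv i - Cst (vv ^ (p + 1 - i)) * Xv p)"
  proof -
    have "i < p" using 4(2) by simp
    \<comment> \<open>With i < p the subtraction in the exponent is not truncated, and i + (p + 1 -
      i) = p + 1.\<close>
    then have "vv * vv ^ p = vv ^ i * vv ^ (p + 1 - i)"
      by (simp flip: power_add power_Suc)
    then have "Cst (vv * vv ^ p) = Cst (vv ^ i * vv ^ (p + 1 - i))"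
      by (rule arg_cong)
    then have "Cst vv * Yv p = Cst (vv ^ i) * (Cst (vv ^ (p + 1 - i)) * Xv p)"
      by (simp only: Cst_mult Yv_def mult.assoc[symmetric])
    then show ?thesis by (simp only: right_diff_distrib) (simp only: Yv_def)
  qed
  have "j < Suc p" if "j \<in> set st" for j
    using that 4(2)[of j] by auto
  from 4(1)[OF this] have "arcs_prod (match_aux (True # xs) p (i # st)) =
     (Yv i - Cst vv * Yv p) * (let r = match_aux xs (Suc p) st in Cst (vv ^ (minus_sum xs (Suc p) + sum_list st)) *
     (\<Prod>(i, j)\<leftarrow>fst r. Xv i - Cst (vv ^ (j + 1 - i)) * Xv j) * (\<Prod>i\<leftarrow>snd r. Xv i))"
    by (simp add: arcs_prod_def Let_def mult.assoc)
  then show ?case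
    unfolding * by (simp add: Let_def power_add Cst_mult mult_ac)
qed

section \<open>Inversions and the positions of the minuses\<close>

lemma minus_positions_Cons:
  "{i. i < length (x # d) \<and> \<not> (x # d) ! i} = (if x then {} else {0}) \<union> Suc ` {i. i < length d \<and> \<not> d ! i}"
  by (auto simp: image_iff less_Suc_eq_0_disj)

lemma minus_prod_shift:
  "minus_prod d p = Cst (vv ^ minus_sum d p) * (\<Prod>i\<in>{i. i < length d \<and> \<not> d ! i}. Xv (p + i))"
proof (induction d p rule: minus_prod.induct)
  case (2 x d p)
  have "(\<Prod>i\<in>{i. i < length (x # d) \<and> \<not> (x # d) ! i}. Xv (p + i)) =
      (if x then 1 else Xv p) * (\<Prod>i\<in>{i. i < length d \<and> \<not> d ! i}. Xv (Suc p + i))"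
    unfolding minus_positions_Cons by (simp add: prod.reindex)
  with 2 show ?case by (simp add: Yv_def power_add Cst_mult ac_simps)
qed simp

lemma minus_prod_monomial: "minus_prod d 0 = Cst (vv ^ minus_sum d 0) * minus_monomial d"
  by (simp add: minus_prod_shift minus_monomial_def)

lemma Ninv_Cons: "Ninv (x # d) = (if x then 0 else length (filter id d)) + Ninv d"
proof -
  let ?I = "\<lambda>d. {(i, j). i < j \<and> j < length d \<and> \<not> d ! i \<and> d ! j}"
  have fin: "finite (?I d)" for d
    by (rule finite_subset[of _ "{..<length d} \<times> {..<length d}"]) auto
  have "?I (x # d) = (if x then {} else (\<lambda>j. (0, Suc j)) ` {j. j < length d \<and> d ! j})
      \<union> map_prod Suc Suc ` ?I d" (is "_ = ?A \<union> ?B")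
  proof (rule set_eqI, clarify)
    fix i j
    show "(i, j) \<in> ?I (x # d) \<longleftrightarrow> (i, j) \<in> ?A \<union> ?B"
      by (cases i; cases j) (auto simp: image_iff)
  qed
  moreover have "?A \<inter> ?B = {}" by auto
  moreover have "finite ?A" "finite ?B" using fin by auto
  moreover have "card ?A = (if x then 0 else length (filter id d))"
    by (simp add: card_image inj_on_def length_filter_conv_card)
  moreover have "card ?B = card (?I d)"
    by (rule card_image) (auto simp: inj_on_def)
  ultimately show ?thesis unfolding Ninv_def by (simp add: card_Un_disjoint)
qed

lemma minus_sum_Suc: "minus_sum d (Suc p) = minus_sum d p + length (filter Not d)"
  by (induction d p rule: minus_sum.induct) auto

text \<open>Moving a minus one place to the right past a plus lowers N by one and raises the sum of
  positions by one. The constant is the value when all pluses come first, where N is 0.\<close>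

lemma Ninv_minus_sum:
  "Ninv d + minus_sum d 0 = length (filter id d) * length (filter Not d) + (length (filter Not d) choose 2)"
proof (induction d)
  case Nil
  then show ?case by (simp add: Ninv_def)
next
  case (Cons x d)
  then show ?case by (simp add: Ninv_Cons minus_sum_Suc numeral_2_eq_2 id_def)
qed

lemma Eset_filter_Not: "d \<in> Eset n k \<Longrightarrow> length (filter Not d) = n - k"
  using sum_length_filter_compl[of id d] by (auto simp: Eset_def)

lemma phi_kl:
  assumes e: "e \<in> Eset n k"
  shows "phi n k (kl e) = Qpoly e"
proof -
  define N where "N = k * (n - k) + (n - k choose 2)"
  have N: "Ninv d + minus_sum d 0 = N" if "d \<in> Eset n k" for d
    using that Ninv_minus_sum[of d] Eset_filter_Not[OF that] by (simp add: N_def Eset_def)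
  \<comment> \<open>The powers of v in \<open>phi\<close> thus turn each x_i into Y_i, up to one
    factor common to all \<open>d\<close>.\<close>
  have split: "inverse vv ^ Ninv d = inverse vv ^ N * vv ^ minus_sum d 0" if "d \<in> Eset n k" for d
    by (simp flip: N[OF that] add: power_add power_inverse)
  have "phi n k (kl e) = (\<Sum>d\<in>Eset n k. Cst (inverse vv ^ N) * (Cst (kl e d) * minus_prod d 0))"
    unfolding phi_def
    by (intro sum.cong refl) (simp add: split minus_prod_monomial Cst_mult ac_simps)
  \<comment> \<open>The coefficients of \<open>kl e\<close> vanish outside \<open>Eset n k\<close>,
    so the sum may run over all lists of length \<open>n\<close>.\<close>
  also have "\<dots> = (\<Sum>d\<in>blists n. Cst (inverse vv ^ N) * (Cst (kl e d) * minus_prod d 0))"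
    using Mspace_eq_0[OF kl_Mspace[OF e]]
    by (intro sum.mono_neutral_left finite_blists) (auto simp: blists_def Eset_def)
  also have "\<dots> = Cst (inverse vv ^ N) * arcs_prod (match_aux e 0 [])"
    using arc_generating[of "[]" e 0] e by (simp add: kl_def Eset_length flip: sum_distrib_left)
  also have "\<dots> = Qpoly e"
    using Qpoly_rescale[of "[]" 0 e]
    by (simp add: Qpoly_def Let_def split[OF e] Cst_mult mult.assoc flip: Qpoly_rescale)
  finally show ?thesis .
qed

theorem mainTheorem5:
  fixes n k :: nat and e :: "bool list"
  assumes "1 \<le> k" and "k \<le> n - 1"
    and "e \<in> Eset n k"
  shows "phi n k (KL_elt n k e) = Qpoly e"
  using phi_kl[OF assms(3)] KL_elt_eq_kl[OF _ assms(3)] assms(2) by simp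

end
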